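(* Let $\ell\in\mathbb{N}=\{1,2,\dots\}$ and $p>1$ be real. Set $$B_p^{(\ell)}:=\left(\left(\tfrac{p-1}{p}\right)_{\ell}\right)^{p}=\left(\prod_{j=0}^{\ell-1}\left(\tfrac{p-1}{p}+j\right)\right)^{p}.$$ Then for every $\varphi\in C_0^\infty(\mathbb{R}_+)$, $$\int_0^\infty\left|\varphi^{(\ell)}(x)\right|^{p}\,\mathrm{d}x\;\ge\;B_p^{(\ell)}\int_0^\infty\frac{|\varphi(x)|^{p}}{x^{\ell p}}\,\mathrm{d}x .$$ Moreover, the constant $B_p^{(\ell)}$ is sharp, i.e. if a real number $B$ is such that $\int_0^\infty|\varphi^{(\ell)}(x)|^{p}\,\mathrm{d}x\ge B\int_0^\infty|\varphi(x)|^{p}x^{-\ell p}\,\mathrm{d}x$ for all $\varphi\in C_0^\infty(\mathbb{R}_+)$, then $B\le B_p^{(\ell)}$.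
   Context: $\mathbb{R}_+=(0,\infty)$ (open half-line), and $C_0^\infty(\mathbb{R}_+)$ is the space of smooth complex-valued functions with compact support contained in $(0,\infty)$. $\varphi^{(\ell)}$ is the $\ell$-th derivative. The Pochhammer symbol is $(a)_\ell:=a(a+1)\cdots(a+\ell-1)$. *)

theory Defs
  imports "HOL-Analysis.Analysis"
begin

(* The library's higher derivative "deriv ^^ n" only covers functions from a field
   to itself, hence the iterated vector derivative for functions of a real variable. *)
definition nth_vector_derivative ::
    "nat \<Rightarrow> (real \<Rightarrow> 'a::real_normed_vector) \<Rightarrow> real \<Rightarrow> 'a" where
  "nth_vector_derivative n f = ((\<lambda>g x. vector_derivative g (at x)) ^^ n) f"

definition smooth :: "(real \<Rightarrow> 'a::real_normed_vector) \<Rightarrow> bool" where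
  "smooth f \<longleftrightarrow> (\<forall>n x. nth_vector_derivative n f differentiable (at x))"

(* C_0^infinity(Omega) for an open set Omega of reals. A function on Omega whose support
   is a compact subset of Omega is identified with its (smooth) extension by zero to
   the whole real line. *)
definition test_functions :: "real set \<Rightarrow> (real \<Rightarrow> complex) set" where
  "test_functions \<Omega> =
     {f. smooth f \<and> compact (closure (support_on UNIV f)) \<and> closure (support_on UNIV f) \<subseteq> \<Omega>}"

definition hardy_rellich_constant :: "nat \<Rightarrow> real \<Rightarrow> real" where
  "hardy_rellich_constant l p = (pochhammer ((p - 1) / p) l) powr p"

end

(* Inequality: integrating the derivative of |f|^p x^(-pc), c = (p-1)/p + r, and applying
   Young's inequality pointwise gives the weighted Hardy inequality
   c^p int |f|^p x^(-(r+1)p) <= int |f'|^p x^(-rp); it is iterated with r = l-1, ..., 0.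
   Sharpness: for a bump function chi and phi(x) = x^s chi(eps ln x), s = l - 1/p, the k-th derivative
   is x^(s-k) v_k(eps ln x) with v_0 = chi and v_(k+1) = (s-k) v_k + eps v_k'.
   Since ps = lp - 1, the two integrals are eps^(-1) int |v_l|^p and eps^(-1) int |chi|^p, and
   v_l tends to (prod_{j<l} (s-j)) chi = ((p-1)/p)_l chi as eps tends to 0. *)
theory Submission
  imports Defs
begin

subsection \<open>The weighted Hardy inequality\<close>

text \<open>The quotient of \<open>norm h powr p\<close> by \<open>norm h\<close> is
  \<open>norm h powr (p - 1)\<close>, which tends to 0 because p > 1. This keeps |f|^p
  differentiable at zeros of f, where the norm itself is not smooth.\<close>

lemma has_derivative_norm_powr_zero:
  fixes p :: real
  assumes "p > 1"
  shows "((\<lambda>z::'a::real_normed_vector. norm z powr p) has_derivative (\<lambda>h. 0)) (at 0)"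
proof -
  have "((\<lambda>h::'a. norm h powr (p - 1)) \<longlongrightarrow> 0) (at 0)"
    by (rule tendsto_zero_powrI[where b = "p - 1"])
       (use assms in \<open>auto intro!: tendsto_norm_zero tendsto_eq_intros\<close>)
  moreover have "norm h powr p / norm h = norm h powr (p - 1)" if "h \<noteq> 0" for h :: 'a
    using that by (simp add: powr_diff)
  ultimately have "((\<lambda>h::'a. norm h powr p / norm h) \<longlongrightarrow> 0) (at 0)"
    by (subst tendsto_cong[where g = "\<lambda>h. norm h powr (p - 1)"])
       (auto simp: eventually_at_filter)
  then show ?thesis
    by (simp add: has_derivative_at)
qed

text \<open>At a zero of f the derivative is 0; elsewhere the gradient of the norm is the unit
  vector \<open>sgn (f x)\<close>, and Cauchy-Schwarz gives the bound. An upper bound is enough,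
  since the derivative is later multiplied by nonnegative factors only.\<close>

lemma norm_powr_has_real_derivative_bound:
  fixes f :: "real \<Rightarrow> 'a::real_inner" and p :: real
  assumes f: "(f has_vector_derivative f') (at x)" and "p > 1"
  obtains D where "((\<lambda>x. norm (f x) powr p) has_real_derivative D) (at x)"
    and "D \<le> p * norm (f x) powr (p - 1) * norm f'"
proof (cases "f x = 0")
  case True
  have "((\<lambda>z. norm z powr p) has_derivative (\<lambda>h. 0)) (at (f x))"
    using has_derivative_norm_powr_zero[OF \<open>p > 1\<close>] True by simp
  from has_derivative_compose[OF f[unfolded has_vector_derivative_def] this]
  have "((\<lambda>x. norm (f x) powr p) has_real_derivative 0) (at x)"
    by (simp add: has_field_derivative_def lambda_zero)
  then show ?thesis
    using that True by simp
next
  case False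
  have "((\<lambda>x. norm (f x)) has_derivative (\<lambda>h. (h *\<^sub>R f') \<bullet> sgn (f x))) (at x)"
    using has_derivative_compose[OF f[unfolded has_vector_derivative_def] has_derivative_norm[OF False]]
    by simp
  then have "((\<lambda>x. norm (f x)) has_real_derivative (f' \<bullet> sgn (f x))) (at x)"
    by (simp add: has_field_derivative_def mult.commute[of _ "f' \<bullet> sgn (f x)"])
  then have D: "((\<lambda>x. norm (f x) powr p) has_real_derivative
      (p * norm (f x) powr (p - 1) * (f' \<bullet> sgn (f x)))) (at x)"
    using False by (auto intro!: derivative_eq_intros DERIV_fun_powr simp: powr_diff)
  have "f' \<bullet> sgn (f x) \<le> norm f' * norm (sgn (f x))"
    by (rule norm_cauchy_schwarz)
  then have "f' \<bullet> sgn (f x) \<le> norm f'"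
    using False by (simp add: norm_sgn)
  then show ?thesis
    using that[OF D] \<open>p > 1\<close> by (simp add: mult_left_mono)
qed

text \<open>Young's inequality with the conjugate exponents p / (p - 1) and p, multiplied by
  p.\<close>

lemma powr_mult_le_powr_sum:
  fixes A D p :: real
  assumes "A \<ge> 0" "D \<ge> 0" "p > 1"
  shows "p * (A powr (p - 1) * D) \<le> (p - 1) * A powr p + D powr p"
proof -
  have "A powr (p - 1) * D \<le> (A powr (p - 1)) powr (p / (p - 1)) / (p / (p - 1)) + D powr p / p"
    by (rule Youngs_inequality) (use assms in \<open>auto simp: field_simps\<close>)
  then show ?thesis
    using assms by (simp add: powr_powr) (simp add: field_simps)
qed

lemma continuous_on_norm_powr:
  fixes f :: "'b::topological_space \<Rightarrow> 'a::real_normed_vector" and p :: real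
  assumes "continuous_on S f" "p > 0"
  shows "continuous_on S (\<lambda>x. norm (f x) powr p)"
  using assms by (intro continuous_on_powr' continuous_intros) auto

lemma continuous_on_norm_powr_divide:
  fixes f :: "real \<Rightarrow> 'a::real_normed_vector" and p q :: real
  assumes "continuous_on S f" "p > 0" "S \<subseteq> {0<..}"
  shows "continuous_on S (\<lambda>x. norm (f x) powr p / x powr q)"
  using assms by (intro continuous_intros continuous_on_norm_powr) auto

text \<open>Vanishing at both ends of the compact interval removes the boundary terms, so
  integrating the pointwise estimate leaves exactly the difference of the two sides.\<close>

lemma weighted_Hardy_inequality:
  fixes f :: "real \<Rightarrow> 'a::real_inner" and p r a b :: real
  assumes f: "\<And>x. x \<in> {a..b} \<Longrightarrow> (f has_vector_derivative f' x) (at x)"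
    and f'_cont: "continuous_on {a..b} f'"
    and zero: "f a = 0" "f b = 0"
    and "0 < a" "a \<le> b" "p > 1" "r \<ge> 0"
  shows "((p - 1) / p + r) powr p *
      integral {a..b} (\<lambda>x. norm (f x) powr p / x powr ((r + 1) * p))
    \<le> integral {a..b} (\<lambda>x. norm (f' x) powr p / x powr (r * p))"
proof -
  define c where "c = (p - 1) / p + r"
  have "c > 0"
    using \<open>p > 1\<close> \<open>r \<ge> 0\<close> by (simp add: c_def add_pos_nonneg)
  \<comment> \<open>With this exponent the derivative of x^(-pc) is -pc times x^(-(r+1)p), the
    weight in \<open>u\<close>.\<close>
  have pc: "p * c = (r + 1) * p - 1"
    using \<open>p > 1\<close> by (simp add: c_def field_simps)
  define u where "u x = norm (f x) powr p / x powr ((r + 1) * p)" for x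
  define v where "v x = norm (f' x) powr p / x powr (r * p)" for x
  have "continuous_on {a..b} f"
    using f by (meson continuous_at_imp_continuous_on has_vector_derivative_continuous)
  then have "continuous_on {a..b} u" "continuous_on {a..b} v"
    unfolding u_def v_def using f'_cont \<open>0 < a\<close> \<open>p > 1\<close>
    by (auto intro!: continuous_on_norm_powr_divide)
  then have int: "u integrable_on {a..b}" "v integrable_on {a..b}"
    using integrable_continuous_real by blast+
  \<comment> \<open>The weight is chosen so that the derivative is dominated by the difference of the two integrands.\<close>
  have "\<exists>D. ((\<lambda>x. norm (f x) powr p * x powr (- (p * c))) has_real_derivative D) (at x) \<and>
      c powr (p - 1) * D \<le> v x - c powr p * u x" if x: "x \<in> {a..b}" for x
  proof -
    have "x > 0"
      using x \<open>0 < a\<close> by auto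
    obtain D where D: "((\<lambda>x. norm (f x) powr p) has_real_derivative D) (at x)"
      and D_le: "D \<le> p * norm (f x) powr (p - 1) * norm (f' x)"
      using norm_powr_has_real_derivative_bound[OF f[OF x] \<open>p > 1\<close>] .
    define E where "E = D * x powr (- (p * c)) - p * c * x powr (- (p * c) - 1) * norm (f x) powr p"
    have "((\<lambda>x. norm (f x) powr p * x powr (- (p * c))) has_real_derivative E) (at x)"
      unfolding E_def
      by (rule derivative_eq_intros D \<open>x > 0\<close> refl)+ (use \<open>x > 0\<close> in \<open>simp add: powr_diff field_simps\<close>)
    moreover have "c powr (p - 1) * E \<le> v x - c powr p * u x"
    proof -
      \<comment> \<open>Young's inequality is applied to \<open>A\<close> and |f'(x)|. These agree
        for f(x) = x^c, the case in which nothing is lost.\<close>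
      define A where "A = c * norm (f x) / x"
      have "A \<ge> 0"
        unfolding A_def using \<open>c > 0\<close> \<open>x > 0\<close> by simp
      have e1: "c powr (p - 1) * (norm (f x) powr (p - 1) * x powr (- (p * c))) = A powr (p - 1) * x powr (- (r * p))"
      proof -
        have "A powr (p - 1) = c powr (p - 1) * norm (f x) powr (p - 1) * x powr (- (p - 1))"
          unfolding A_def powr_minus using \<open>c > 0\<close> \<open>x > 0\<close>
          by (simp add: powr_divide powr_mult field_simps)
        moreover have "x powr (- (p - 1)) * x powr (- (r * p)) = x powr (- (p * c))"
          unfolding pc by (simp add: algebra_simps flip: powr_add)
        ultimately show ?thesis by (simp add: mult.assoc)
      qed
      have e2: "c powr p * u x = A powr p * x powr (- (r * p))"
      proof -
        have "A powr p = c powr p * norm (f x) powr p * x powr (- p)"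
          unfolding A_def powr_minus using \<open>c > 0\<close> \<open>x > 0\<close>
          by (simp add: powr_divide powr_mult field_simps)
        moreover have "x powr (- p) * x powr (- (r * p)) = inverse (x powr ((r + 1) * p))"
          by (simp add: algebra_simps flip: powr_add powr_minus)
        ultimately show ?thesis by (simp add: u_def divide_inverse mult.assoc)
      qed
      have e3: "c powr (p - 1) * (p * c * x powr (- (p * c) - 1) * norm (f x) powr p) = p * (c powr p * u x)"
      proof -
        have "x powr (- (p * c) - 1) = x powr (- ((r + 1) * p))"
          by (simp add: pc)
        then show ?thesis
          unfolding u_def using \<open>c > 0\<close> by (simp add: powr_minus powr_diff divide_inverse)
      qed
      have "c powr (p - 1) * (D * x powr (- (p * c)))
          \<le> c powr (p - 1) * ((p * norm (f x) powr (p - 1) * norm (f' x)) * x powr (- (p * c)))"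
        by (intro mult_left_mono mult_right_mono D_le) auto
      also have "\<dots> = p * norm (f' x) * (c powr (p - 1) * (norm (f x) powr (p - 1) * x powr (- (p * c))))"
        by simp
      also have "\<dots> = p * (A powr (p - 1) * norm (f' x)) * x powr (- (r * p))"
        unfolding e1 by simp
      also have "\<dots> \<le> ((p - 1) * A powr p + norm (f' x) powr p) * x powr (- (r * p))"
        by (intro mult_right_mono powr_mult_le_powr_sum \<open>A \<ge> 0\<close> \<open>p > 1\<close>) auto
      also have "\<dots> = (p - 1) * (c powr p * u x) + v x"
        unfolding e2 v_def by (simp add: powr_minus divide_inverse algebra_simps)
      \<comment> \<open>Of the p copies of \<open>c powr p * u x\<close> subtracted in the scaled
        \<open>E\<close>, Young's inequality gives back p - 1, which leaves one.\<close>
      finally show ?thesis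
        unfolding E_def right_diff_distrib e3 by (simp add: algebra_simps)
    qed
    ultimately show ?thesis by blast
  qed
  then have "\<exists>E. \<forall>x\<in>{a..b}. ((\<lambda>x. norm (f x) powr p * x powr (- (p * c))) has_real_derivative E x) (at x) \<and>
      c powr (p - 1) * E x \<le> v x - c powr p * u x"
    by (intro bchoice ballI)
  then obtain E where E:
    "\<And>x. x \<in> {a..b} \<Longrightarrow> ((\<lambda>x. norm (f x) powr p * x powr (- (p * c))) has_real_derivative E x) (at x)"
    "\<And>x. x \<in> {a..b} \<Longrightarrow> c powr (p - 1) * E x \<le> v x - c powr p * u x"
    by blast
  \<comment> \<open>\<open>E\<close> is a pointwise choice with no formula at hand; the gauge
    integral still integrates a derivative to the boundary difference.\<close>
  have "(E has_integral
      (norm (f b) powr p * b powr (- (p * c)) - norm (f a) powr p * a powr (- (p * c)))) {a..b}"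
    by (rule fundamental_theorem_of_calculus[OF \<open>a \<le> b\<close>])
       (use E(1) in \<open>auto intro: has_vector_derivative_at_within
          simp: has_real_derivative_iff_has_vector_derivative\<close>)
  from has_integral_mult_right[OF this, of "c powr (p - 1)"]
  have "((\<lambda>x. c powr (p - 1) * E x) has_integral 0) {a..b}"
    using zero by simp
  moreover have "((\<lambda>x. v x - c powr p * u x) has_integral
      (integral {a..b} v - c powr p * integral {a..b} u)) {a..b}"
    by (intro has_integral_diff has_integral_mult_right integrable_integral int)
  ultimately have "0 \<le> integral {a..b} v - c powr p * integral {a..b} u"
    by (rule has_integral_le) (use E(2) in auto)
  then show ?thesis
    by (simp add: c_def u_def v_def[abs_def] u_def[abs_def])
qed

text \<open>The weighted inequality with r = n trades the weight x^(-(n+1)p) for x^(-np), one more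
  derivative and the last Pochhammer factor. The remaining n steps start from
  \<open>F (Suc k)\<close>, so k has to vary in the induction.\<close>

lemma iterated_Hardy_inequality:
  fixes F :: "nat \<Rightarrow> real \<Rightarrow> 'a::real_inner" and p a b :: real
  assumes F: "\<And>n x. (F n has_vector_derivative F (Suc n) x) (at x)"
    and zero: "\<And>n. F n a = 0" "\<And>n. F n b = 0"
    and "0 < a" "a \<le> b" "p > 1"
  shows "pochhammer ((p - 1) / p) n powr p *
      integral {a..b} (\<lambda>x. norm (F k x) powr p / x powr (real n * p))
    \<le> integral {a..b} (\<lambda>x. norm (F (k + n) x) powr p)"
proof (induction n arbitrary: k)
  case 0
  have "integral {a..b} (\<lambda>x. norm (F k x) powr p / x powr (real 0 * p))
      = integral {a..b} (\<lambda>x. norm (F k x) powr p)"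
    by (rule integral_cong) (use \<open>0 < a\<close> in auto)
  then show ?case by simp
next
  case (Suc n)
  have cont: "continuous_on {a..b} (F (Suc k))"
    using F by (meson continuous_at_imp_continuous_on has_vector_derivative_continuous)
  have "pochhammer ((p - 1) / p) (Suc n) powr p *
      integral {a..b} (\<lambda>x. norm (F k x) powr p / x powr (real (Suc n) * p))
    = pochhammer ((p - 1) / p) n powr p * (((p - 1) / p + real n) powr p *
      integral {a..b} (\<lambda>x. norm (F k x) powr p / x powr ((real n + 1) * p)))"
    using \<open>p > 1\<close>
    by (simp add: pochhammer_Suc powr_mult pochhammer_nonneg add.commute[of 1])
  also have "\<dots> \<le> pochhammer ((p - 1) / p) n powr p *
      integral {a..b} (\<lambda>x. norm (F (Suc k) x) powr p / x powr (real n * p))"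
    by (intro mult_left_mono weighted_Hardy_inequality F cont zero \<open>0 < a\<close> \<open>a \<le> b\<close> \<open>p > 1\<close>) auto
  also have "\<dots> \<le> integral {a..b} (\<lambda>x. norm (F (k + Suc n) x) powr p)"
    using Suc[of "Suc k"] by simp
  finally show ?case .
qed

subsection \<open>Iterated vector derivatives\<close>

lemma nth_vector_derivative_Suc:
  "nth_vector_derivative (Suc n) f = (\<lambda>x. vector_derivative (nth_vector_derivative n f) (at x))"
  by (simp add: nth_vector_derivative_def)

lemma nth_vector_derivative_0: "nth_vector_derivative 0 f = f"
  by (simp add: nth_vector_derivative_def)

lemma smooth_has_vector_derivative:
  assumes "smooth f"
  shows "(nth_vector_derivative n f has_vector_derivative nth_vector_derivative (Suc n) f x) (at x)"
  using assms by (simp add: smooth_def nth_vector_derivative_Suc vector_derivative_works)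

text \<open>Identifies the iterated derivatives of a function given together with an explicit chain
  of derivatives, as for the test functions below.\<close>

lemma nth_vector_derivative_unique:
  assumes "\<And>n x. (F n has_vector_derivative F (Suc n) x) (at x)"
  shows "nth_vector_derivative n (F 0) = F n"
proof (induction n)
  case (Suc n)
  then show ?case
    using vector_derivative_at[OF assms[of n]] by (auto simp: nth_vector_derivative_Suc)
qed (simp add: nth_vector_derivative_0)

lemma smoothI:
  assumes "\<And>n x. (F n has_vector_derivative F (Suc n) x) (at x)"
  shows "smooth (F 0)"
  unfolding smooth_def
  using assms nth_vector_derivative_unique[of F, OF assms]
  by (metis differentiableI_vector)

text \<open>The complement of the support is open, so near each of its points every derivative is
  obtained by differentiating the zero function.\<close>

lemma nth_vector_derivative_eq_0:
  assumes "x \<notin> closure (support_on UNIV f)"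
  shows "nth_vector_derivative n f x = 0"
proof -
  have "\<forall>x \<in> - closure (support_on UNIV f). nth_vector_derivative n f x = 0"
  proof (induction n)
    case 0
    then show ?case
      using closure_subset[of "support_on UNIV f"]
      by (auto simp: nth_vector_derivative_0 support_on_def)
  next
    case (Suc n)
    have "(nth_vector_derivative n f has_vector_derivative 0) (at x)"
      if "x \<in> - closure (support_on UNIV f)" for x
      by (rule has_vector_derivative_transform_within_open[OF has_vector_derivative_const _ that])
         (use Suc in \<open>auto simp: open_Compl\<close>)
    then show ?case
      by (auto simp: nth_vector_derivative_Suc vector_derivative_at)
  qed
  then show ?thesis
    using assms by blast
qed

text \<open>Passes from the Lebesgue integrals of the theorem to gauge integrals over a compact
  interval, for which the Hardy inequality and the substitution are proved.\<close>

lemma set_lebesgue_integral_eq_integral_Icc: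
  fixes f :: "real \<Rightarrow> 'a::euclidean_space"
  assumes "continuous_on {a..b} f" "{a..b} \<subseteq> S" "\<And>x. x \<in> S - {a..b} \<Longrightarrow> f x = 0"
  shows "(LINT x:S|lborel. f x) = integral {a..b} f"
proof -
  have "(LINT x:S|lborel. f x) = (LINT x:{a..b}|lborel. f x)"
    unfolding set_lebesgue_integral_def
    by (rule Bochner_Integration.integral_cong) (use assms in \<open>auto simp: indicator_def\<close>)
  then show ?thesis
    using set_borel_integral_eq_integral(2)[OF borel_integrable_atLeastAtMost'[OF assms(1)]] by simp
qed

text \<open>The enclosing interval is open so that functions supported in K vanish at a and b
  themselves, as the Hardy inequality on [a, b] requires.\<close>

lemma compact_subset_greaterThan_0:
  fixes K :: "real set"
  assumes "compact K" "K \<subseteq> {0<..}"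
  obtains a b where "0 < a" "a \<le> b" "K \<subseteq> {a<..<b}"
proof (cases "K = {}")
  case True
  then show ?thesis using that[of 1 1] by simp
next
  case False
  obtain m M where mM: "m \<in> K" "\<And>x. x \<in> K \<Longrightarrow> m \<le> x" "\<And>x. x \<in> K \<Longrightarrow> x \<le> M"
    using compact_attains_inf[OF assms(1) False] compact_attains_sup[OF assms(1) False] by metis
  then have "0 < m" using assms by auto
  show ?thesis
    by (rule that[of "m / 2" "M + 1"]) (use mM \<open>0 < m\<close> in \<open>fastforce+\<close>)
qed

subsection \<open>A smooth bump function and its logarithmic rescaling\<close>

text \<open>The difference quotient is at most C |h|. This serves the points |y| \<ge> 1 of the
  bump, including the gluing points 1 and -1.\<close>

lemma DERIV_zero_if_quadratic_bound:
  fixes F :: "real \<Rightarrow> real"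
  assumes "\<And>z. \<bar>F z - F y\<bar> \<le> C * (z - y)\<^sup>2"
  shows "(F has_real_derivative 0) (at y)"
proof -
  have "((\<lambda>h. (F (y + h) - F y) / h) \<longlongrightarrow> 0) (at 0)"
  proof (rule tendsto_0_le[where K = C])
    show "((\<lambda>h::real. h) \<longlongrightarrow> 0) (at 0)" by (rule tendsto_ident_at)
    have "norm ((F (y + h) - F y) / h) \<le> norm h * C" if "h \<noteq> 0" for h
      using assms[of "y + h"] that by (simp add: field_simps power2_eq_square flip: abs_mult)
    then show "\<forall>\<^sub>F h in at 0. norm ((F (y + h) - F y) / h) \<le> norm h * C"
      by (simp add: eventually_at_filter)
  qed
  then show ?thesis by (simp add: DERIV_def)
qed

text \<open>A single term, that of index m + 2, of the exponential series at 1 / w bounds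
  \<open>exp (1 / w)\<close> from below; the surplus 2 yields the quadratic decay.\<close>

lemma exp_minus_inverse_le:
  fixes w :: real
  assumes "w > 0"
  shows "exp (- (1 / w)) / w ^ m \<le> fact (m + 2) * w\<^sup>2"
proof -
  have "(\<Sum>n\<in>{m + 2}. (1 / w) ^ n /\<^sub>R fact n) \<le> (\<Sum>n. (1 / w) ^ n /\<^sub>R fact n)"
    by (rule sum_le_suminf) (use assms in \<open>auto simp: summable_exp\<close>)
  then have "(1 / w) ^ (m + 2) / fact (m + 2) \<le> exp (1 / w)"
    by (simp add: exp_def divide_inverse mult.commute)
  then have "1 / (w ^ m * w\<^sup>2) \<le> exp (1 / w) * fact (m + 2)"
    by (simp add: power_divide power_add pos_divide_le_eq[OF fact_gt_zero, symmetric] mult.assoc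
        del: fact_Suc add_2_eq_Suc')
  then show ?thesis
    using assms by (simp add: exp_minus field_simps del: fact_Suc add_2_eq_Suc')
qed

text \<open>Numerators of the derivatives of exp(-1/(1-y^2)): the n-th derivative on (-1, 1) has
  denominator (1-y^2)^(2n), and \<open>[:1, 0, -1:]\<close> is 1-y^2. The recursion is the product
  rule over the common denominator (1-y^2)^(2n+2).\<close>

primrec bump_poly :: "nat \<Rightarrow> real poly" where
  "bump_poly 0 = 1"
| "bump_poly (Suc n) = pderiv (bump_poly n) * [:1, 0, -1:]\<^sup>2
     + [:0, 4 * real n:] * [:1, 0, -1:] * bump_poly n - [:0, 2:] * bump_poly n"

definition bump :: "nat \<Rightarrow> real \<Rightarrow> real" where
  "bump n y = (if \<bar>y\<bar> < 1
     then poly (bump_poly n) y / (1 - y\<^sup>2) ^ (2 * n) * exp (- (1 / (1 - y\<^sup>2))) else 0)"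

lemma bump_eq_0: "\<bar>y\<bar> \<ge> 1 \<Longrightarrow> bump n y = 0"
  by (simp add: bump_def)

lemma bump_0_pos: "\<bar>y\<bar> < 1 \<Longrightarrow> bump 0 y > 0"
  by (simp add: bump_def)

text \<open>Inside (-1, 1) this is the recursion of \<open>bump_poly\<close>. At all other points
  the value is 0 and the exponential decay gives a quadratic bound, hence derivative 0.\<close>

lemma DERIV_bump: "(bump n has_real_derivative bump (Suc n) y) (at y)"
proof (cases "\<bar>y\<bar> < 1")
  case True
  let ?g = "\<lambda>y::real. poly (bump_poly n) y / (1 - y\<^sup>2) ^ (2 * n) * exp (- (1 / (1 - y\<^sup>2)))"
  define w where "w = 1 - y\<^sup>2"
  have "w > 0"
    using True by (simp add: w_def abs_square_less_1)
  have "(?g has_real_derivative bump (Suc n) y) (at y)"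
  proof -
    have d: "((\<lambda>y. 1 / (1 - y\<^sup>2) ^ (2 * n)) has_real_derivative 4 * real n * y / w ^ (2 * n + 1)) (at y)"
    proof (cases n)
      case (Suc k)
      show ?thesis
        unfolding Suc
        by (rule derivative_eq_intros refl | use \<open>w > 0\<close> in \<open>simp add: w_def\<close>)+
    qed simp
    have e: "((\<lambda>y. exp (- (1 / (1 - y\<^sup>2)))) has_real_derivative
        - 2 * y / w\<^sup>2 * exp (- (1 / w))) (at y)"
    proof -
      have "((\<lambda>y. - (1 / (1 - y\<^sup>2))) has_real_derivative - 2 * y / w\<^sup>2) (at y)"
        using \<open>w > 0\<close>
        by (auto intro!: derivative_eq_intros simp: w_def power2_eq_square)
      from DERIV_fun_exp[OF this] show ?thesis
        by (simp add: w_def mult.commute)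
    qed
    have b: "bump (Suc n) y = (poly (pderiv (bump_poly n)) y * w\<^sup>2 + 4 * real n * y * w * poly (bump_poly n) y
        - 2 * y * poly (bump_poly n) y) / w ^ (2 * n + 2) * exp (- (1 / w))"
      using True by (simp add: bump_def w_def power2_eq_square algebra_simps)
    have *: "bump (Suc n) y = (poly (pderiv (bump_poly n)) y * (1 / w ^ (2 * n)) +
        4 * real n * y / w ^ (2 * n + 1) * poly (bump_poly n) y) * exp (- (1 / w)) +
        - 2 * y / w\<^sup>2 * exp (- (1 / w)) * (poly (bump_poly n) y * (1 / w ^ (2 * n)))"
      unfolding b using \<open>w > 0\<close> by (simp add: field_simps power_add power2_eq_square)
    show ?thesis
      unfolding * using DERIV_mult[OF DERIV_mult[OF poly_DERIV[of "bump_poly n" y] d] e]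
      by (simp add: w_def)
  qed
  then show ?thesis
    by (rule has_field_derivative_transform_within_open[where S = "{-1<..<1}"])
       (use True in \<open>auto simp: bump_def\<close>)
next
  case False
  have "bounded (poly (bump_poly n) ` {-1..1})"
    by (intro compact_imp_bounded compact_continuous_image continuous_intros compact_Icc)
  then obtain M where M: "\<And>z. z \<in> {-1..1} \<Longrightarrow> \<bar>poly (bump_poly n) z\<bar> \<le> M"
    unfolding bounded_iff by (metis imageI real_norm_def)
  then have "M \<ge> 0" using M[of 0] by force
  \<comment> \<open>\<open>M\<close> bounds the polynomial, the factorial comes from
    \<open>exp_minus_inverse_le\<close> with m = 2n, and 4 from comparing w^2 with (z -
    y)^2.\<close>
  define C where "C = 4 * M * fact (2 * n + 2)"
  have "\<bar>bump n z - bump n y\<bar> \<le> C * (z - y)\<^sup>2" for z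
  proof (cases "\<bar>z\<bar> < 1")
    case True
    define w where "w = 1 - z\<^sup>2"
    have "w > 0"
      using True by (simp add: w_def abs_square_less_1)
    \<comment> \<open>Since |z| < 1 \<le> |y|, the first factor is at most |z - y| and the second at
      most 2.\<close>
    have "w = (1 - \<bar>z\<bar>) * (1 + \<bar>z\<bar>)"
      by (simp add: w_def algebra_simps power2_eq_square)
    also have "\<dots> \<le> \<bar>z - y\<bar> * 2"
      by (intro mult_mono) (use True False in auto)
    finally have "w\<^sup>2 \<le> (\<bar>z - y\<bar> * 2)\<^sup>2"
      using \<open>w > 0\<close> by (intro power_mono) auto
    then have w2: "w\<^sup>2 \<le> 4 * (z - y)\<^sup>2" by (simp add: power_mult_distrib)
    have "\<bar>bump n z - bump n y\<bar> = \<bar>poly (bump_poly n) z\<bar> * (exp (- (1 / w)) / w ^ (2 * n))"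
      using True False \<open>w > 0\<close> by (simp add: bump_def abs_mult flip: w_def)
    also have "\<dots> \<le> M * (fact (2 * n + 2) * (4 * (z - y)\<^sup>2))"
      by (intro mult_mono M order.trans[OF exp_minus_inverse_le[OF \<open>w > 0\<close>]] mult_left_mono w2)
         (use True \<open>M \<ge> 0\<close> \<open>w > 0\<close> in auto)
    finally show ?thesis by (simp add: C_def mult_ac)
  next
    case F: False
    then show ?thesis using False \<open>M \<ge> 0\<close> by (simp add: bump_def C_def)
  qed
  then have "(bump n has_real_derivative 0) (at y)"
    by (rule DERIV_zero_if_quadratic_bound)
  then show ?thesis using False by (simp add: bump_eq_0)
qed

lemma continuous_on_bump: "continuous_on A (bump n)"
  using DERIV_bump by (meson DERIV_continuous continuous_at_imp_continuous_on)

section \<open>Logarithmically rescaled test functions\<close>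

text \<open>\<open>log_deriv s \<epsilon> k i\<close> is the \<open>i\<close>-th derivative of the profile \<open>v\<^sub>k\<close> for which
  the \<open>k\<close>-th derivative of \<open>x powr s * bump 0 (\<epsilon> * ln x)\<close> is \<open>x powr (s - k) * v\<^sub>k (\<epsilon> * ln x)\<close>.\<close>
primrec log_deriv :: "real \<Rightarrow> real \<Rightarrow> nat \<Rightarrow> nat \<Rightarrow> real \<Rightarrow> real" where
  "log_deriv s \<epsilon> 0 i = bump i"
| "log_deriv s \<epsilon> (Suc k) i =
     (\<lambda>y. (s - real k) * log_deriv s \<epsilon> k i y + \<epsilon> * log_deriv s \<epsilon> k (Suc i) y)"

lemma DERIV_log_deriv:
  "(log_deriv s \<epsilon> k i has_real_derivative log_deriv s \<epsilon> k (Suc i) y) (at y)"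
  by (induction k arbitrary: i) (auto intro!: derivative_eq_intros DERIV_bump)

lemma log_deriv_eq_0: "\<bar>y\<bar> \<ge> 1 \<Longrightarrow> log_deriv s \<epsilon> k i y = 0"
  by (induction k arbitrary: i) (auto simp: bump_eq_0)

text \<open>At \<epsilon> = 0 the profile is not differentiated; only the factors from
  differentiating x^s survive. They produce the sharp constant.\<close>

lemma log_deriv_0: "log_deriv s 0 k i y = (\<Prod>j<k. s - real j) * bump i y"
  by (induction k arbitrary: i) auto

text \<open>Joint continuity in \<epsilon> and y is what allows \<epsilon> to tend to 0 under the
  integral.\<close>

lemma continuous_on_log_deriv: "continuous_on UNIV (\<lambda>(\<epsilon>, y). log_deriv s \<epsilon> k i y)"
proof (induction k arbitrary: i)
  case 0
  show ?case
    by (auto simp: case_prod_beta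
        intro!: continuous_intros continuous_on_compose2[OF continuous_on_bump[of UNIV i]])
next
  case (Suc k)
  then show ?case
    by (auto simp: case_prod_beta intro!: continuous_intros)
qed

definition scaled_bump :: "real \<Rightarrow> real \<Rightarrow> nat \<Rightarrow> real \<Rightarrow> real" where
  "scaled_bump s \<epsilon> k x = (if x > 0 then x powr (s - real k) * log_deriv s \<epsilon> k 0 (\<epsilon> * ln x) else 0)"

lemma scaled_bump_eq_0:
  assumes "\<epsilon> > 0" "x \<notin> {exp (- (1 / \<epsilon>))..exp (1 / \<epsilon>)}"
  shows "scaled_bump s \<epsilon> k x = 0"
proof (cases "x > 0")
  case True
  then have "\<bar>\<epsilon> * ln x\<bar> \<ge> 1"
  proof -
    have "x < exp (- (1 / \<epsilon>)) \<or> exp (1 / \<epsilon>) < x"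
      using assms(2) by auto
    then have "ln x < - (1 / \<epsilon>) \<or> 1 / \<epsilon> < ln x"
      using ln_less_cancel_iff[of x "exp (- (1 / \<epsilon>))"] ln_less_cancel_iff[of "exp (1 / \<epsilon>)" x] True
      by auto
    then show ?thesis
      using assms(1) by (auto simp: field_simps abs_if)
  qed
  then show ?thesis by (simp add: scaled_bump_def log_deriv_eq_0)
qed (simp add: scaled_bump_def)

lemma DERIV_scaled_bump:
  assumes "\<epsilon> > 0"
  shows "(scaled_bump s \<epsilon> k has_real_derivative scaled_bump s \<epsilon> (Suc k) x) (at x)"
proof (cases "x > 0")
  case True
  have "((\<lambda>x. x powr (s - real k) * log_deriv s \<epsilon> k 0 (\<epsilon> * ln x)) has_real_derivative
      scaled_bump s \<epsilon> (Suc k) x) (at x)"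
    using True
    by (auto intro!: derivative_eq_intros DERIV_chain2[OF DERIV_log_deriv]
        simp: scaled_bump_def powr_diff powr_add field_simps)
  then show ?thesis
    by (rule has_field_derivative_transform_within_open[where S = "{0<..}"])
       (use True in \<open>auto simp: scaled_bump_def\<close>)
next
  case False
  \<comment> \<open>The support starts at \<open>exp (- (1 / \<epsilon>))\<close> > 0, so the
    function is zero on a whole neighbourhood of every x \<le> 0, the gluing point 0
    included.\<close>
  have "(scaled_bump s \<epsilon> k has_real_derivative 0) (at x)"
    by (rule has_field_derivative_transform_within_open[OF DERIV_const, where S = "{..<exp (- (1 / \<epsilon>))}"])
       (use False in \<open>auto simp: scaled_bump_eq_0 assms intro: le_less_trans[of _ 0]\<close>)
  then show ?thesis using False by (simp add: scaled_bump_def)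
qed

subsection \<open>The Hardy--Rellich inequality and its sharpness\<close>

text \<open>The substitution y = \<epsilon> ln x turns dx / x into dy / \<epsilon> and maps the
  support into [-1, 1].\<close>

lemma set_lebesgue_integral_log_substitution:
  fixes h :: "real \<Rightarrow> real"
  assumes cont: "continuous_on UNIV h" and zero: "\<And>y. \<bar>y\<bar> \<ge> 1 \<Longrightarrow> h y = 0" and "\<epsilon> > 0"
  shows "(LINT x:{0<..}|lborel. h (\<epsilon> * ln x) / x) = integral {-1..1} h / \<epsilon>"
proof -
  define a b where "a = exp (- (1 / \<epsilon>))" and "b = exp (1 / \<epsilon>)"
  have ab: "0 < a" "a \<le> b" "\<epsilon> * ln a = -1" "\<epsilon> * ln b = 1"
    using \<open>\<epsilon> > 0\<close> by (auto simp: a_def b_def)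
  have outside: "h (\<epsilon> * ln x) / x = 0" if "x \<in> {0<..} - {a..b}" for x
  proof -
    have "ln x < ln a \<or> ln b < ln x"
      using that ab by auto
    then have "\<epsilon> * ln x < -1 \<or> 1 < \<epsilon> * ln x"
      using mult_strict_left_mono[OF _ \<open>\<epsilon> > 0\<close>] ab by metis
    then have "\<bar>\<epsilon> * ln x\<bar> \<ge> 1"
      by linarith
    then show ?thesis
      by (simp add: zero)
  qed
  have cont': "continuous_on {a..b} (\<lambda>x. h (\<epsilon> * ln x) / x)"
    by (intro continuous_intros continuous_on_compose2[OF cont]) (use ab in auto)
  have "((\<lambda>x. (\<epsilon> / x) *\<^sub>R h (\<epsilon> * ln x)) has_integral integral {\<epsilon> * ln a..\<epsilon> * ln b} h) {a..b}"
  proof (rule has_integral_substitution[where c = "-1" and d = 1])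
    show "(\<lambda>x. \<epsilon> * ln x) ` {a..b} \<subseteq> {-1..1}"
    proof safe
      fix x assume x: "x \<in> {a..b}"
      then have "\<epsilon> * ln a \<le> \<epsilon> * ln x" "\<epsilon> * ln x \<le> \<epsilon> * ln b"
        using ab(1) \<open>\<epsilon> > 0\<close> by (simp_all add: mult_left_mono)
      then show "\<epsilon> * ln x \<in> {-1..1}" using ab by simp
    qed
    show "continuous_on {-1..1} h"
      using cont continuous_on_subset by blast
  qed (use ab in \<open>auto intro!: derivative_eq_intros\<close>)
  from has_integral_mult_right[OF this, of "1 / \<epsilon>"]
  have "integral {a..b} (\<lambda>x. h (\<epsilon> * ln x) / x) = integral {-1..1} h / \<epsilon>"
    using ab \<open>\<epsilon> > 0\<close> by (simp add: integral_unique)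
  moreover have "{a..b} \<subseteq> {0<..}"
    using ab(1) by auto
  ultimately show ?thesis
    by (simp only: set_lebesgue_integral_eq_integral_Icc[OF cont' _ outside])
qed

lemma scaled_bump_vector_derivative:
  assumes "\<epsilon> > 0"
  shows "((\<lambda>x. complex_of_real (scaled_bump s \<epsilon> k x)) has_vector_derivative
    complex_of_real (scaled_bump s \<epsilon> (Suc k) x)) (at x)"
  using DERIV_scaled_bump[OF assms]
  by (auto intro!: has_vector_derivative_of_real simp: has_real_derivative_iff_has_vector_derivative)

lemma nth_vector_derivative_scaled_bump:
  assumes "\<epsilon> > 0"
  shows "nth_vector_derivative k (\<lambda>x. complex_of_real (scaled_bump s \<epsilon> 0 x))
    = (\<lambda>x. complex_of_real (scaled_bump s \<epsilon> k x))"
  using nth_vector_derivative_unique[of "\<lambda>k x. complex_of_real (scaled_bump s \<epsilon> k x)" k]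
    scaled_bump_vector_derivative[OF assms] by blast

lemma scaled_bump_test_function:
  assumes "\<epsilon> > 0"
  shows "(\<lambda>x. complex_of_real (scaled_bump s \<epsilon> 0 x)) \<in> test_functions {0<..}" (is "?f \<in> _")
proof -
  let ?K = "{exp (- (1 / \<epsilon>))..exp (1 / \<epsilon>)}"
  have "smooth ?f"
    using smoothI[of "\<lambda>k x. complex_of_real (scaled_bump s \<epsilon> k x)"]
      scaled_bump_vector_derivative[OF assms] by blast
  moreover have "support_on UNIV ?f \<subseteq> ?K"
    using scaled_bump_eq_0[OF assms, of _ s 0] by (fastforce simp: support_on_def)
  then have K: "closure (support_on UNIV ?f) \<subseteq> ?K"
    by (rule closure_minimal) simp
  moreover have "compact (closure (support_on UNIV ?f))"
    using K by (meson bounded_closed_interval bounded_subset closed_closure compact_eq_bounded_closed)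
  moreover have "?K \<subseteq> {0<..}"
    by (auto intro: less_le_trans[OF exp_gt_zero])
  ultimately show ?thesis
    unfolding test_functions_def by blast
qed

text \<open>All derivatives of \<phi> vanish outside one interval (a, b) with a > 0, so both
  integrals live on [a, b], where the iterated inequality applies with k = 0 and n = l.\<close>

lemma hardy_rellich_inequality:
  fixes p :: real
  assumes "p > 1" and \<phi>: "\<phi> \<in> test_functions {0<..}"
  shows "hardy_rellich_constant l p * (LINT x:{0<..}|lborel. norm (\<phi> x) powr p / x powr (real l * p))
    \<le> (LINT x:{0<..}|lborel. norm (nth_vector_derivative l \<phi> x) powr p)"
proof -
  define K where "K = closure (support_on UNIV \<phi>)"
  have "smooth \<phi>" "compact K" "K \<subseteq> {0<..}"
    using \<phi> by (auto simp: test_functions_def K_def)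
  then obtain a b where ab: "0 < a" "a \<le> b" "K \<subseteq> {a<..<b}"
    using compact_subset_greaterThan_0 by metis
  let ?F = "\<lambda>n. nth_vector_derivative n \<phi>"
  have D: "(?F n has_vector_derivative ?F (Suc n) x) (at x)" for n x
    by (rule smooth_has_vector_derivative[OF \<open>smooth \<phi>\<close>])
  have zero: "?F n x = 0" if "x \<notin> {a<..<b}" for n x
    using that ab(3) nth_vector_derivative_eq_0[of x \<phi> n] unfolding K_def by blast
  have cont: "continuous_on {a..b} (?F n)" for n
    using D by (meson continuous_at_imp_continuous_on has_vector_derivative_continuous)
  have "(LINT x:{0<..}|lborel. norm (\<phi> x) powr p / x powr (real l * p))
      = integral {a..b} (\<lambda>x. norm (\<phi> x) powr p / x powr (real l * p))"
    by (rule set_lebesgue_integral_eq_integral_Icc)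
       (use ab cont[of 0] zero[of _ 0] \<open>p > 1\<close> in
         \<open>auto simp: nth_vector_derivative_0 intro!: continuous_on_norm_powr_divide\<close>)
  moreover have "(LINT x:{0<..}|lborel. norm (?F l x) powr p) = integral {a..b} (\<lambda>x. norm (?F l x) powr p)"
    by (rule set_lebesgue_integral_eq_integral_Icc)
       (use ab cont[of l] zero[of _ l] \<open>p > 1\<close> in
         \<open>auto intro!: continuous_on_norm_powr\<close>)
  ultimately show ?thesis
    using iterated_Hardy_inequality[of ?F a b p l 0, OF D zero zero ab(1,2) \<open>p > 1\<close>]
    by (simp add: hardy_rellich_constant_def nth_vector_derivative_0)
qed

section \<open>Sharpness of the constant\<close>

lemma prod_eq_pochhammer:
  fixes z :: "'a::comm_ring_1"
  shows "(\<Prod>j<l. z + of_nat l - 1 - of_nat j) = pochhammer z l"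
proof -
  \<comment> \<open>The descending factors are the ascending ones in reverse order. For z = (p-1)/p
    the first of them, z + l - 1, is the exponent s = l - 1/p used below.\<close>
  have "(\<Prod>j<l. z + of_nat l - 1 - of_nat j) = (\<Prod>j<l. z + of_nat (l - Suc j))"
    by (rule prod.cong) (auto simp: of_nat_diff algebra_simps)
  also have "\<dots> = (\<Prod>j<l. z + of_nat j)"
    by (rule prod.nat_diff_reindex)
  finally show ?thesis
    by (simp add: pochhammer_prod lessThan_atLeast0)
qed

lemma hardy_rellich_sharp:
  fixes p B :: real
  assumes "p > 1"
    and B: "\<And>\<phi>. \<phi> \<in> test_functions {0<..} \<Longrightarrow>
      B * (LINT x:{0<..}|lborel. norm (\<phi> x) powr p / x powr (real l * p))
        \<le> (LINT x:{0<..}|lborel. norm (nth_vector_derivative l \<phi> x) powr p)"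
  shows "B \<le> hardy_rellich_constant l p"
proof -
  define s where "s = real l - 1 / p"
  define F where "F \<epsilon> = integral {-1..1} (\<lambda>y. \<bar>log_deriv s \<epsilon> l 0 y\<bar> powr p)" for \<epsilon>
  define N where "N = integral {-1..1} (\<lambda>y. \<bar>bump 0 y\<bar> powr p)"
  have cont_bump: "continuous_on A (\<lambda>y. \<bar>bump 0 y\<bar> powr p)" for A
    using continuous_on_norm_powr[OF continuous_on_bump[of A 0], of p] \<open>p > 1\<close> by simp
  have cont_log: "continuous_on UNIV (\<lambda>y. \<bar>log_deriv s \<epsilon> l 0 y\<bar> powr p)" for \<epsilon>
  proof -
    have "continuous_on UNIV (log_deriv s \<epsilon> l 0)"
      using DERIV_log_deriv by (meson DERIV_continuous continuous_at_imp_continuous_on)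
    then show ?thesis
      using continuous_on_norm_powr[of UNIV "log_deriv s \<epsilon> l 0" p] \<open>p > 1\<close> by simp
  qed
  \<comment> \<open>By these identities both integrands, for the l-th derivative and for the
    weighted function, become a function of \<epsilon> ln x divided by x. Both integrals then carry
    the same factor 1/\<epsilon>, which cancels.\<close>
  have exponent: "(s - real l) * p = -1" "s * p = real l * p - 1"
    using \<open>p > 1\<close> by (simp_all add: s_def field_simps)
  have "B * N \<le> F \<epsilon>" if "\<epsilon> > 0" for \<epsilon>
  proof -
    have "(LINT x:{0<..}|lborel. norm (complex_of_real (scaled_bump s \<epsilon> 0 x)) powr p / x powr (real l * p))
        = (LINT x:{0<..}|lborel. \<bar>bump 0 (\<epsilon> * ln x)\<bar> powr p / x)"
      by (rule set_lebesgue_integral_cong)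
         (auto simp: scaled_bump_def norm_mult powr_mult powr_powr exponent powr_diff)
    also have "\<dots> = N / \<epsilon>"
      unfolding N_def using \<open>p > 1\<close> \<open>\<epsilon> > 0\<close>
      by (intro set_lebesgue_integral_log_substitution[of "\<lambda>y. \<bar>bump 0 y\<bar> powr p"] cont_bump)
         (auto simp: bump_eq_0)
    finally have 1: "(LINT x:{0<..}|lborel. norm (complex_of_real (scaled_bump s \<epsilon> 0 x)) powr p
      / x powr (real l * p)) = N / \<epsilon>" .
    have "(LINT x:{0<..}|lborel. norm (complex_of_real (scaled_bump s \<epsilon> l x)) powr p)
        = (LINT x:{0<..}|lborel. \<bar>log_deriv s \<epsilon> l 0 (\<epsilon> * ln x)\<bar> powr p / x)"
      by (rule set_lebesgue_integral_cong)
         (auto simp: scaled_bump_def norm_mult powr_mult powr_powr exponent powr_minus divide_inverse)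
    also have "\<dots> = F \<epsilon> / \<epsilon>"
      unfolding F_def using \<open>p > 1\<close> \<open>\<epsilon> > 0\<close>
      by (intro set_lebesgue_integral_log_substitution[of "\<lambda>y. \<bar>log_deriv s \<epsilon> l 0 y\<bar> powr p"] cont_log)
         (auto simp: log_deriv_eq_0)
    finally show ?thesis
      using B[OF scaled_bump_test_function[OF that, of s]] that
      by (simp add: 1[simplified] nth_vector_derivative_scaled_bump divide_le_cancel)
  qed
  \<comment> \<open>\<open>F\<close> makes sense at \<epsilon> = 0, while the test functions exist
    only for \<epsilon> > 0. Continuity of a parameter integral over a compact interval carries the
    bound to the limit.\<close>
  moreover have "(F \<longlongrightarrow> F 0) (at_right 0)"
  proof -
    have "continuous_on (UNIV \<times> cbox (-1) 1) (\<lambda>(\<epsilon>, y). log_deriv s \<epsilon> l 0 y)"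
      by (rule continuous_on_subset[OF continuous_on_log_deriv]) simp
    then have "continuous_on (UNIV \<times> cbox (-1) 1) (\<lambda>(\<epsilon>, y). \<bar>log_deriv s \<epsilon> l 0 y\<bar> powr p)"
      using continuous_on_norm_powr[of _ "\<lambda>(\<epsilon>, y). log_deriv s \<epsilon> l 0 y" p] \<open>p > 1\<close>
      by (simp add: case_prod_beta)
    from integral_continuous_on_param[OF this] have "continuous_on UNIV F"
      by (simp add: F_def[abs_def])
    then show ?thesis
      by (simp add: continuous_on_def) (metis filterlim_at_split tendsto_within_subset top_greatest)
  qed
  ultimately have "B * N \<le> F 0"
    by (intro tendsto_lowerbound[of F]) (auto simp: eventually_at_right_less eventually_at_filter)
  also have "F 0 = hardy_rellich_constant l p * N"
  proof -
    have "(\<Prod>j<l. s - real j) = pochhammer ((p - 1) / p) l"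
      using prod_eq_pochhammer[of "(p - 1) / p" l] \<open>p > 1\<close> by (simp add: s_def diff_divide_distrib)
    moreover have "pochhammer ((p - 1) / p) l \<ge> 0"
      using \<open>p > 1\<close> by (intro pochhammer_nonneg) simp
    ultimately show ?thesis
      by (simp add: F_def N_def log_deriv_0 abs_mult powr_mult hardy_rellich_constant_def)
  qed
  \<comment> \<open>Strict positivity permits cancelling N; the integrand is continuous, nonnegative
    and positive at y = 0.\<close>
  moreover have "N > 0"
  proof -
    have "N \<noteq> 0"
      unfolding N_def using integral_eq_0_iff[OF cont_bump[of "{-1..1}"]] bump_0_pos[of 0]
      by fastforce
    moreover have "N \<ge> 0"
      unfolding N_def by (rule integral_nonneg[OF integrable_continuous_real[OF cont_bump]]) simp
    ultimately show ?thesis by simp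
  qed
  ultimately show ?thesis by simp
qed

theorem theorem7:
  fixes l :: nat and p :: real
  assumes "l \<ge> 1" and "p > 1"
  shows "(\<forall>\<phi> \<in> test_functions {0<..}.
            (LINT x:{0<..}|lborel. norm (nth_vector_derivative l \<phi> x) powr p)
              \<ge> hardy_rellich_constant l p *
                 (LINT x:{0<..}|lborel. norm (\<phi> x) powr p / x powr (real l * p)))
       \<and> (\<forall>B::real.
            (\<forall>\<phi> \<in> test_functions {0<..}.
               (LINT x:{0<..}|lborel. norm (nth_vector_derivative l \<phi> x) powr p)
                 \<ge> B * (LINT x:{0<..}|lborel. norm (\<phi> x) powr p / x powr (real l * p)))
            \<longrightarrow> B \<le> hardy_rellich_constant l p)"
  using hardy_rellich_inequality[OF \<open>p > 1\<close>] hardy_rellich_sharp[OF \<open>p > 1\<close>] by blast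

end
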